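(* $\mathsf{LinExp}$ is effectively closed under taking minima: for all $h,h'\in\mathsf{LinExp}$ one can compute a linear expectation $h''\in\mathsf{LinExp}$ with $h''(\sigma)=\min\{h(\sigma),h'(\sigma)\}$ for every state $\sigma$.
   Context: Program variables form a finite set $\mathsf{Vars}$; a state is a map $\sigma\colon\mathsf{Vars}\to\mathbb{N}$. Linear expressions: $e::= r\mid x\mid r\cdot e\mid e+e\mid e\mathbin{\dot-}e$ with $r\in\mathbb{Q}_{\ge0}$, $x\in\mathsf{Vars}$, where $\dot-$ is subtraction truncated at $0$. Extended linear expressions: $\tilde e::= e\mid\infty$. Linear guards: $\varphi::= e<e\mid\varphi\wedge\varphi\mid\neg\varphi$ (with $e$ linear expressions, no $\infty$). Linear expectations $\mathsf{LinExp}$: $h::=\tilde e\mid[\varphi]\cdot h\mid h+h$, evaluated on states pointwise (values in $\mathbb{R}_{\ge0}\cup\{\infty\}$) with $[\varphi](\sigma)\in\{0,1\}$ the truth value of $\varphi$, $0\cdot\infty=0$ and $a+\infty=\infty$. *)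

theory Defs
  imports "HOL-Library.Extended_Nonnegative_Real" "HOL-Library.Nat_Bijection"
begin

section \<open>Syntax and semantics of linear expectations\<close>

text \<open>The program variables are the elements of a type \<open>'v\<close>, which is required to be finite
  where it matters.\<close>

type_synonym 'v state = "'v \<Rightarrow> nat"

typedef nnrat = "{r :: rat. 0 \<le> r}"
  by auto

datatype 'v lexpr =
    Const nnrat
  | Var 'v
  | Scale nnrat "'v lexpr"
  | Add "'v lexpr" "'v lexpr"
  | Monus "'v lexpr" "'v lexpr"

datatype 'v ext_lexpr =
    Finite "'v lexpr"
  | Infty

datatype 'v guard =
    Less "'v lexpr" "'v lexpr"
  | Conj "'v guard" "'v guard"
  | Neg "'v guard"

datatype 'v linexp =
    Expr "'v ext_lexpr"
  | Iverson "'v guard" "'v linexp"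
  | Plus "'v linexp" "'v linexp"

primrec eval_lexpr :: "'v lexpr \<Rightarrow> 'v state \<Rightarrow> real" where
  "eval_lexpr (Const r) \<sigma> = of_rat (Rep_nnrat r)"
| "eval_lexpr (Var x) \<sigma> = real (\<sigma> x)"
| "eval_lexpr (Scale r e) \<sigma> = of_rat (Rep_nnrat r) * eval_lexpr e \<sigma>"
| "eval_lexpr (Add e e') \<sigma> = eval_lexpr e \<sigma> + eval_lexpr e' \<sigma>"
| "eval_lexpr (Monus e e') \<sigma> = max 0 (eval_lexpr e \<sigma> - eval_lexpr e' \<sigma>)"

text \<open>In particular the coercion \<open>ennreal\<close> used below never cuts off a negative value.\<close>

lemma eval_lexpr_nonneg: "0 \<le> eval_lexpr e \<sigma>"
  using Rep_nnrat by (induction e) auto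

primrec eval_ext_lexpr :: "'v ext_lexpr \<Rightarrow> 'v state \<Rightarrow> ennreal" where
  "eval_ext_lexpr (Finite e) \<sigma> = ennreal (eval_lexpr e \<sigma>)"
| "eval_ext_lexpr Infty \<sigma> = \<infinity>"

primrec eval_guard :: "'v guard \<Rightarrow> 'v state \<Rightarrow> bool" where
  "eval_guard (Less e e') \<sigma> \<longleftrightarrow> eval_lexpr e \<sigma> < eval_lexpr e' \<sigma>"
| "eval_guard (Conj \<phi> \<psi>) \<sigma> \<longleftrightarrow> eval_guard \<phi> \<sigma> \<and> eval_guard \<psi> \<sigma>"
| "eval_guard (Neg \<phi>) \<sigma> \<longleftrightarrow> \<not> eval_guard \<phi> \<sigma>"

primrec eval_linexp :: "'v linexp \<Rightarrow> 'v state \<Rightarrow> ennreal" where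
  "eval_linexp (Expr e) \<sigma> = eval_ext_lexpr e \<sigma>"
| "eval_linexp (Iverson \<phi> h) \<sigma> = of_bool (eval_guard \<phi> \<sigma>) * eval_linexp h \<sigma>"
| "eval_linexp (Plus h h') \<sigma> = eval_linexp h \<sigma> + eval_linexp h' \<sigma>"


section \<open>Computability\<close>

text \<open>The partial recursive functions on the natural numbers, presented as unary functions with
  the help of the pairing function \<open>prod_encode\<close>. In the rule for unbounded minimisation, the
  search at \<open>n\<close> succeeds only if the function is defined at all smaller arguments.\<close>

inductive partial_recursive :: "(nat \<Rightarrow> nat option) \<Rightarrow> bool" where
  zero: "partial_recursive (\<lambda>n. Some 0)"
| succ: "partial_recursive (\<lambda>n. Some (Suc n))"
| left: "partial_recursive (\<lambda>n. Some (fst (prod_decode n)))"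
| right: "partial_recursive (\<lambda>n. Some (snd (prod_decode n)))"
| pair: "\<lbrakk>partial_recursive f; partial_recursive g\<rbrakk> \<Longrightarrow>
    partial_recursive
      (\<lambda>n. Option.bind (f n) (\<lambda>a. Option.bind (g n) (\<lambda>b. Some (prod_encode (a, b)))))"
| comp: "\<lbrakk>partial_recursive f; partial_recursive g\<rbrakk> \<Longrightarrow>
    partial_recursive (\<lambda>n. Option.bind (g n) f)"
| prec: "\<lbrakk>partial_recursive f; partial_recursive g\<rbrakk> \<Longrightarrow>
    partial_recursive
      (\<lambda>n. rec_nat (f (fst (prod_decode n)))
        (\<lambda>k r. Option.bind r
          (\<lambda>i. g (prod_encode (fst (prod_decode n), prod_encode (k, i)))))
        (snd (prod_decode n)))"
| mu: "partial_recursive f \<Longrightarrow>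
    partial_recursive
      (\<lambda>a. if \<exists>n. f (prod_encode (a, n)) = Some 0 \<and> (\<forall>m<n. f (prod_encode (a, m)) \<noteq> None)
            then Some (LEAST n. f (prod_encode (a, n)) = Some 0)
            else None)"

text \<open>Codes of the syntactic objects, relative to a numbering \<open>\<nu>\<close> of the program variables.
  Rationals are coded by numerator and denominator in lowest terms. The library's \<open>to_nat\<close> is of
  no use here because it rests on an unspecified choice of an injection.\<close>

definition encode_nnrat :: "nnrat \<Rightarrow> nat" where
  "encode_nnrat r = (case quotient_of (Rep_nnrat r) of (p, q) \<Rightarrow> prod_encode (nat p, nat q))"

primrec encode_lexpr :: "('v \<Rightarrow> nat) \<Rightarrow> 'v lexpr \<Rightarrow> nat" where
  "encode_lexpr \<nu> (Const r) = prod_encode (0, encode_nnrat r)"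
| "encode_lexpr \<nu> (Var x) = prod_encode (1, \<nu> x)"
| "encode_lexpr \<nu> (Scale r e) =
    prod_encode (2, prod_encode (encode_nnrat r, encode_lexpr \<nu> e))"
| "encode_lexpr \<nu> (Add e e') =
    prod_encode (3, prod_encode (encode_lexpr \<nu> e, encode_lexpr \<nu> e'))"
| "encode_lexpr \<nu> (Monus e e') =
    prod_encode (4, prod_encode (encode_lexpr \<nu> e, encode_lexpr \<nu> e'))"

primrec encode_ext_lexpr :: "('v \<Rightarrow> nat) \<Rightarrow> 'v ext_lexpr \<Rightarrow> nat" where
  "encode_ext_lexpr \<nu> (Finite e) = prod_encode (0, encode_lexpr \<nu> e)"
| "encode_ext_lexpr \<nu> Infty = prod_encode (1, 0)"

primrec encode_guard :: "('v \<Rightarrow> nat) \<Rightarrow> 'v guard \<Rightarrow> nat" where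
  "encode_guard \<nu> (Less e e') =
    prod_encode (0, prod_encode (encode_lexpr \<nu> e, encode_lexpr \<nu> e'))"
| "encode_guard \<nu> (Conj \<phi> \<psi>) =
    prod_encode (1, prod_encode (encode_guard \<nu> \<phi>, encode_guard \<nu> \<psi>))"
| "encode_guard \<nu> (Neg \<phi>) = prod_encode (2, encode_guard \<nu> \<phi>)"

primrec encode_linexp :: "('v \<Rightarrow> nat) \<Rightarrow> 'v linexp \<Rightarrow> nat" where
  "encode_linexp \<nu> (Expr e) = prod_encode (0, encode_ext_lexpr \<nu> e)"
| "encode_linexp \<nu> (Iverson \<phi> h) =
    prod_encode (1, prod_encode (encode_guard \<nu> \<phi>, encode_linexp \<nu> h))"
| "encode_linexp \<nu> (Plus h h') =
    prod_encode (2, prod_encode (encode_linexp \<nu> h, encode_linexp \<nu> h'))"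

text \<open>For finite \<open>'v\<close>, this notion does not depend on the injective numbering \<open>\<nu>\<close>, since
  translating between two of them is a finite table lookup.\<close>

definition computable_binop ::
    "('v \<Rightarrow> nat) \<Rightarrow> ('v linexp \<Rightarrow> 'v linexp \<Rightarrow> 'v linexp) \<Rightarrow> bool" where
  "computable_binop \<nu> F \<longleftrightarrow>
    (\<exists>g. partial_recursive g \<and>
      (\<forall>h h'. g (prod_encode (encode_linexp \<nu> h, encode_linexp \<nu> h'))
        = Some (encode_linexp \<nu> (F h h'))))"

end

theory Submission
  imports Defs
begin

text \<open>View a linear expectation as a decision tree: under a state, only some of its summands, the
  active leaves, survive the Iverson brackets, and its value is the sum of the active leaves.
  Splitting each bracket \<open>[\<phi>] \<cdot> h\<close> into \<open>[\<phi>] \<cdot> h + [\<not> \<phi>] \<cdot> 0\<close> and distributing sums over the leaves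
  makes exactly one leaf active under every state. On such trees the minimum can be
  taken leaf by leaf, with \<open>min e e' = e - (e - e')\<close> for truncated subtraction. All of this
  is structural recursion on expectations, which is computable on codes because the codes of
  subexpressions are smaller.\<close>

section \<open>Total recursive functions\<close>

definition recursive :: "(nat \<Rightarrow> nat) \<Rightarrow> bool" where
  "recursive f \<longleftrightarrow> partial_recursive (\<lambda>n. Some (f n))"

named_theorems recursive_intros

lemma recursive_comp:
  assumes "recursive f" "recursive g"
  shows "recursive (\<lambda>n. f (g n))"
  using partial_recursive.comp[OF assms[unfolded recursive_def]] by (simp add: recursive_def)

lemma recursive_pair [recursive_intros]:
  assumes "recursive f" "recursive g"
  shows "recursive (\<lambda>n. prod_encode (f n, g n))"
  using partial_recursive.pair[OF assms[unfolded recursive_def]] by (simp add: recursive_def)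

lemma recursive_fst [recursive_intros]:
  "recursive f \<Longrightarrow> recursive (\<lambda>n. fst (prod_decode (f n)))"
  using recursive_comp[of "\<lambda>n. fst (prod_decode n)" f] partial_recursive.left
  by (simp add: recursive_def)

lemma recursive_snd [recursive_intros]:
  "recursive f \<Longrightarrow> recursive (\<lambda>n. snd (prod_decode (f n)))"
  using recursive_comp[of "\<lambda>n. snd (prod_decode n)" f] partial_recursive.right
  by (simp add: recursive_def)

lemma recursive_Suc [recursive_intros]:
  "recursive f \<Longrightarrow> recursive (\<lambda>n. Suc (f n))"
  using recursive_comp[of Suc f] partial_recursive.succ by (simp add: recursive_def)

text \<open>Re-pairing the two projections recovers the argument, as every number codes a
  pair.\<close>

lemma recursive_id [recursive_intros]: "recursive (\<lambda>n. n)"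
  using partial_recursive.pair[OF partial_recursive.left partial_recursive.right]
  by (simp add: recursive_def)

lemma recursive_const [recursive_intros]: "recursive (\<lambda>n. c)"
proof (induction c)
  case 0
  show ?case by (simp add: recursive_def partial_recursive.zero)
qed (rule recursive_Suc)

section \<open>Primitive recursion and basic arithmetic\<close>

text \<open>The rule \<open>prec\<close> reads parameter and counter from one pair; composing it
  with the pair of \<open>n\<close> and \<open>h n\<close> frees the number of iterations.\<close>

lemma recursive_rec_nat:
  assumes "recursive f" "recursive g" "recursive h"
  shows "recursive (\<lambda>n. rec_nat (f n) (\<lambda>k i. g (prod_encode (n, prod_encode (k, i)))) (h n))"
proof -
  \<comment> \<open>With a total base and step no \<open>None\<close> ever arises, so the
    \<open>Option.bind\<close> recursion collapses to an ordinary one.\<close>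
  have rec: "rec_nat (Some a) (\<lambda>k r. Option.bind r (\<lambda>i. Some (u k i))) m = Some (rec_nat a u m)"
    for a :: nat and u m
    by (induction m) auto
  have "recursive (\<lambda>n. rec_nat (f (fst (prod_decode n)))
      (\<lambda>k i. g (prod_encode (fst (prod_decode n), prod_encode (k, i)))) (snd (prod_decode n)))"
    using partial_recursive.prec[OF assms(1,2)[unfolded recursive_def]]
    by (simp add: recursive_def rec)
  from recursive_comp[OF this recursive_pair[OF recursive_id assms(3)]] show ?thesis by simp
qed

text \<open>Case distinction is a recursion whose step ignores the previous value.\<close>

lemma recursive_if_zero [recursive_intros]:
  assumes "recursive f" "recursive g" "recursive h"
  shows "recursive (\<lambda>n. if h n = 0 then f n else g n)"
proof -
  have "recursive (\<lambda>m. g (fst (prod_decode m)))"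
    by (intro recursive_intros recursive_comp[OF assms(2)])
  from recursive_rec_nat[OF assms(1) this assms(3)]
  have "recursive (\<lambda>n. rec_nat (f n) (\<lambda>k i. g n) (h n))"
    by simp
  moreover have "(\<lambda>n. if h n = 0 then f n else g n) = (\<lambda>n. rec_nat (f n) (\<lambda>k i. g n) (h n))"
    by (auto simp: fun_eq_iff gr0_conv_Suc)
  ultimately show ?thesis by (simp only:)
qed

lemma recursive_pred [recursive_intros]:
  assumes "recursive f"
  shows "recursive (\<lambda>n. f n - 1)"
proof -
  \<comment> \<open>This step projects to the counter \<open>k\<close>, whose last value is one
    below the argument.\<close>
  have "recursive (\<lambda>m. fst (prod_decode (snd (prod_decode m))))"
    by (intro recursive_intros)
  from recursive_rec_nat[OF recursive_const this assms, of 0]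
  have "recursive (\<lambda>n. rec_nat 0 (\<lambda>k i. k) (f n))"
    by simp
  moreover have "rec_nat 0 (\<lambda>k i. k) m = m - 1" for m :: nat
    by (cases m) auto
  ultimately show ?thesis by (simp only:)
qed

lemma recursive_minus [recursive_intros]:
  assumes "recursive f" "recursive g"
  shows "recursive (\<lambda>n. f n - g n)"
proof -
  have "recursive (\<lambda>m. snd (prod_decode (snd (prod_decode m))) - 1)"
    by (intro recursive_intros)
  from recursive_rec_nat[OF assms(1) this assms(2)]
  have "recursive (\<lambda>n. rec_nat (f n) (\<lambda>k i. i - 1) (g n))"
    by simp
  moreover have "rec_nat a (\<lambda>k i. i - 1) b = a - b" for a b :: nat
    by (induction b) auto
  ultimately show ?thesis by (simp only:)
qed

lemma recursive_funpow_snd [recursive_intros]: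
  assumes "recursive f" "recursive g"
  shows "recursive (\<lambda>n. ((\<lambda>m. snd (prod_decode m)) ^^ g n) (f n))"
proof -
  have "recursive (\<lambda>m. snd (prod_decode (snd (prod_decode (snd (prod_decode m))))))"
    by (intro recursive_intros)
  from recursive_rec_nat[OF assms(1) this assms(2)]
  have "recursive (\<lambda>n. rec_nat (f n) (\<lambda>k i. snd (prod_decode i)) (g n))"
    by simp
  moreover have "rec_nat a (\<lambda>k i. snd (prod_decode i)) b = ((\<lambda>m. snd (prod_decode m)) ^^ b) a"
    for a b
    by (induction b) auto
  ultimately show ?thesis by (simp only:)
qed


section \<open>Course-of-values recursion\<close>

text \<open>The values at \<open>n - 1, \<dots>, 0\<close> as nested pairs, most recent first, so that the value at \<open>i\<close>
  is found below \<open>n - Suc i\<close> entries.\<close>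

definition history :: "(nat \<Rightarrow> nat) \<Rightarrow> nat \<Rightarrow> nat \<Rightarrow> nat" where
  "history G p = rec_nat 0
    (\<lambda>k t. prod_encode (G (prod_encode (p, prod_encode (k, t))), t))"

lemma history_Suc:
  "history G p (Suc n) =
    prod_encode (G (prod_encode (p, prod_encode (n, history G p n))), history G p n)"
  by (simp add: history_def)

lemma recursive_history:
  assumes "recursive G" "recursive f" "recursive g"
  shows "recursive (\<lambda>n. history G (f n) (g n))"
proof -
  have "recursive (\<lambda>m. prod_encode (G (prod_encode (f (fst (prod_decode m)), snd (prod_decode m))),
      snd (prod_decode (snd (prod_decode m)))))"
    by (intro recursive_intros recursive_comp[OF assms(1)] recursive_comp[OF assms(2)])
  from recursive_rec_nat[OF recursive_const this assms(3), of 0] show ?thesis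
    by (simp add: history_def)
qed

lemma funpow_snd_history:
  assumes "m \<le> n"
  shows "((\<lambda>m. snd (prod_decode m)) ^^ (n - m)) (history G p n) = history G p m"
  using assms
proof (induction n rule: dec_induct)
  case (step n)
  from step.hyps(1) have "Suc n - m = Suc (n - m)" by simp
  \<comment> \<open>\<open>funpow_Suc_right\<close> applies the additional projection first, where
    it strips the newest entry.\<close>
  then show ?case
    using step.IH by (simp only: funpow_Suc_right history_Suc comp_def prod_encode_inverse snd_conv)
qed simp

definition history_nth :: "nat \<Rightarrow> nat \<Rightarrow> nat \<Rightarrow> nat" where
  "history_nth t n i =
    fst (prod_decode (((\<lambda>m. snd (prod_decode m)) ^^ (n - Suc i)) t))"

text \<open>Stripping down to the history of length \<open>Suc i\<close> puts entry \<open>i\<close>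
  on top. It was computed from the history up to \<open>i\<close>, so it does not depend on
  \<open>n\<close>.\<close>

lemma history_nth_history:
  assumes "i < n"
  shows "history_nth (history G p n) n i = G (prod_encode (p, prod_encode (i, history G p i)))"
  using funpow_snd_history[of "Suc i" n G p] assms by (simp add: history_nth_def history_Suc)

lemma recursive_history_nth [recursive_intros]:
  "recursive f \<Longrightarrow> recursive g \<Longrightarrow> recursive h \<Longrightarrow>
    recursive (\<lambda>n. history_nth (f n) (g n) (h n))"
  unfolding history_nth_def by (intro recursive_intros)

section \<open>Folds over codes of expectations\<close>

text \<open>Justifies history lookups at subcodes. The tag must be positive, since
  \<open>prod_encode (0, 0) = 0\<close>; \<open>Iverson\<close> and \<open>Plus\<close> have tags 1
  and 2.\<close>

lemma less_prod_encode_Suc: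
  "a < prod_encode (Suc t, prod_encode (a, b))" "b < prod_encode (Suc t, prod_encode (a, b))"
proof -
  have "prod_encode (a, b) < prod_encode (Suc t, prod_encode (a, b))"
    by (simp add: prod_encode_def)
  then show "a < prod_encode (Suc t, prod_encode (a, b))"
    and "b < prod_encode (Suc t, prod_encode (a, b))"
    using le_prod_encode_1[of a b] le_prod_encode_2[of b a] by linarith+
qed

text \<open>Each constructor is replaced by a recursive function on codes. The parameter
  \<open>p\<close> is passed down unchanged to the leaves; it carries the other operand of a binary
  operation.\<close>

lemma recursive_fold_linexp:
  fixes \<nu> :: "'v \<Rightarrow> nat"
  assumes "recursive E" "recursive I" "recursive P"
  obtains f where "recursive f"
    and "\<And>p e. f (prod_encode (p, encode_linexp \<nu> (Expr e))) =
      E (prod_encode (p, encode_ext_lexpr \<nu> e))"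
    and "\<And>p \<phi> h. f (prod_encode (p, encode_linexp \<nu> (Iverson \<phi> h))) =
      I (prod_encode (encode_guard \<nu> \<phi>, f (prod_encode (p, encode_linexp \<nu> h))))"
    and "\<And>p h h'. f (prod_encode (p, encode_linexp \<nu> (Plus h h'))) =
      P (prod_encode (f (prod_encode (p, encode_linexp \<nu> h)),
        f (prod_encode (p, encode_linexp \<nu> h'))))"
proof -
  \<comment> \<open>Here \<open>t\<close> is the history below \<open>n\<close>. Tags are told apart
    by zero tests, and every tag beyond 1 is treated as \<open>Plus\<close>. For tag 1,
    \<open>a\<close> is the guard code and is used as it stands.\<close>
  define step where "step p n t =
    (let x = snd (prod_decode n); a = fst (prod_decode x); b = snd (prod_decode x) in
      if fst (prod_decode n) = 0 then E (prod_encode (p, x))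
      else if fst (prod_decode n) - 1 = 0 then I (prod_encode (a, history_nth t n b))
      else P (prod_encode (history_nth t n a, history_nth t n b)))" for p n t
  define G where "G m = step (fst (prod_decode m)) (fst (prod_decode (snd (prod_decode m))))
    (snd (prod_decode (snd (prod_decode m))))" for m
  have "recursive G"
    unfolding G_def step_def Let_def
    by (intro recursive_intros assms[THEN recursive_comp])
  \<comment> \<open>Supplying \<open>G\<close> with its own history ties the knot: lookups below
    \<open>n\<close> become values of \<open>f\<close>.\<close>
  define f where "f m = G (prod_encode (fst (prod_decode m), prod_encode (snd (prod_decode m),
    history G (fst (prod_decode m)) (snd (prod_decode m)))))" for m
  have nth: "history_nth (history G p n) n i = f (prod_encode (p, i))" if "i < n" for p n i
    using history_nth_history[OF that] by (simp add: f_def)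
  have f: "f (prod_encode (p, n)) = step p n (history G p n)" for p n
    by (simp add: f_def G_def)
  show thesis
  proof
    show "recursive f"
      unfolding f_def
      by (intro recursive_intros recursive_comp[OF \<open>recursive G\<close>]
          recursive_history[OF \<open>recursive G\<close>])
    show "f (prod_encode (p, encode_linexp \<nu> (Expr e))) =
        E (prod_encode (p, encode_ext_lexpr \<nu> e))" for p e
      by (simp add: f step_def)
    show "f (prod_encode (p, encode_linexp \<nu> (Iverson \<phi> h))) =
      I (prod_encode (encode_guard \<nu> \<phi>, f (prod_encode (p, encode_linexp \<nu> h))))" for p \<phi> h
      \<comment> \<open>Only this outer call is unfolded, so that the recursive calls on the right
        stay intact and match the lookups rewritten by \<open>nth\<close>.\<close>
      unfolding f[of p "encode_linexp \<nu> (Iverson \<phi> h)"]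
      using less_prod_encode_Suc[where t = 0] by (simp add: step_def nth)
    show "f (prod_encode (p, encode_linexp \<nu> (Plus h h'))) =
      P (prod_encode (f (prod_encode (p, encode_linexp \<nu> h)),
        f (prod_encode (p, encode_linexp \<nu> h'))))" for p h h'
      unfolding f[of p "encode_linexp \<nu> (Plus h h')"]
      using less_prod_encode_Suc[where t = "Suc 0"]
      by (simp add: step_def nth numeral_2_eq_2)
  qed
qed


section \<open>Leafwise operations on expectations\<close>

primrec active_leaves :: "'v linexp \<Rightarrow> 'v state \<Rightarrow> 'v ext_lexpr list" where
  "active_leaves (Expr e) \<sigma> = [e]"
| "active_leaves (Iverson \<phi> h) \<sigma> = (if eval_guard \<phi> \<sigma> then active_leaves h \<sigma> else [])"
| "active_leaves (Plus h h') \<sigma> = active_leaves h \<sigma> @ active_leaves h' \<sigma>"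

lemma eval_linexp_active_leaves:
  "eval_linexp h \<sigma> = (\<Sum>e\<leftarrow>active_leaves h \<sigma>. eval_ext_lexpr e \<sigma>)"
  by (induction h) auto

primrec map_leaves :: "('v ext_lexpr \<Rightarrow> 'v ext_lexpr) \<Rightarrow> 'v linexp \<Rightarrow> 'v linexp" where
  "map_leaves f (Expr e) = Expr (f e)"
| "map_leaves f (Iverson \<phi> h) = Iverson \<phi> (map_leaves f h)"
| "map_leaves f (Plus h h') = Plus (map_leaves f h) (map_leaves f h')"

text \<open>Grafts a transformed copy of \<open>k\<close> onto each leaf of \<open>h\<close>, so
  that all pairs of leaves get combined.\<close>

primrec map_leaves2 ::
    "('v ext_lexpr \<Rightarrow> 'v ext_lexpr \<Rightarrow> 'v ext_lexpr) \<Rightarrow> 'v linexp \<Rightarrow> 'v linexp \<Rightarrow> 'v linexp" where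
  "map_leaves2 f (Expr e) k = map_leaves (f e) k"
| "map_leaves2 f (Iverson \<phi> h) k = Iverson \<phi> (map_leaves2 f h k)"
| "map_leaves2 f (Plus h h') k = Plus (map_leaves2 f h k) (map_leaves2 f h' k)"

lemma active_leaves_map_leaves:
  "active_leaves (map_leaves f h) \<sigma> = map f (active_leaves h \<sigma>)"
  by (induction h) auto

lemma active_leaves_map_leaves2:
  "active_leaves (map_leaves2 f h k) \<sigma> =
    concat (map (\<lambda>e. map (f e) (active_leaves k \<sigma>)) (active_leaves h \<sigma>))"
  by (induction h) (auto simp: active_leaves_map_leaves)

section \<open>Addition and minimum of single leaves\<close>

fun ext_add :: "'v ext_lexpr \<Rightarrow> 'v ext_lexpr \<Rightarrow> 'v ext_lexpr" where
  "ext_add (Finite e) (Finite e') = Finite (Add e e')"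
| "ext_add _ _ = Infty"

fun ext_min :: "'v ext_lexpr \<Rightarrow> 'v ext_lexpr \<Rightarrow> 'v ext_lexpr" where
  "ext_min (Finite e) (Finite e') = Finite (Monus e (Monus e e'))"
| "ext_min (Finite e) Infty = Finite e"
| "ext_min Infty e = e"

lemma eval_ext_add:
  "eval_ext_lexpr (ext_add e e') \<sigma> = eval_ext_lexpr e \<sigma> + eval_ext_lexpr e' \<sigma>"
  by (induction e e' rule: ext_add.induct) (auto simp: eval_lexpr_nonneg)

lemma eval_ext_min:
  "eval_ext_lexpr (ext_min e e') \<sigma> = min (eval_ext_lexpr e \<sigma>) (eval_ext_lexpr e' \<sigma>)"
proof (induction e e' rule: ext_min.induct)
  case (1 e e')
  \<comment> \<open>Nonnegativity makes the outer truncation harmless: the difference is already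
    \<open>a\<close> or \<open>b\<close>.\<close>
  have "max 0 (a - max 0 (a - b)) = min a b" if "0 \<le> a" "0 \<le> b" for a b :: real
    using that by auto
  then show ?case
    by (auto simp: eval_lexpr_nonneg min_def ennreal_le_iff)
qed (auto simp: min_def top_unique)

section \<open>Splitting into trees with one active leaf\<close>

abbreviation zero_ext :: "'v ext_lexpr" where
  "zero_ext \<equiv> Finite (Const (Abs_nnrat 0))"

primrec split_leaves :: "'v linexp \<Rightarrow> 'v linexp" where
  "split_leaves (Expr e) = Expr e"
| "split_leaves (Iverson \<phi> h) =
    Plus (Iverson \<phi> (split_leaves h)) (Iverson (Neg \<phi>) (Expr zero_ext))"
| "split_leaves (Plus h h') = map_leaves2 ext_add (split_leaves h) (split_leaves h')"

lemma active_leaves_split_leaves: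
  obtains e where "active_leaves (split_leaves h) \<sigma> = [e]"
    and "eval_ext_lexpr e \<sigma> = eval_linexp h \<sigma>"
proof (induction h arbitrary: thesis)
  case (Iverson \<phi> h)
  from Iverson.IH obtain e where "active_leaves (split_leaves h) \<sigma> = [e]"
    "eval_ext_lexpr e \<sigma> = eval_linexp h \<sigma>" .
  then show ?case
    \<comment> \<open>Exactly one of the complementary guards holds; if it is the negated one, the
      zero leaf accounts for the factor 0.\<close>
    by (intro Iverson.prems[of "if eval_guard \<phi> \<sigma> then e else zero_ext"])
       (auto simp: Abs_nnrat_inverse)
next
  case (Plus h h')
  from Plus.IH(1) obtain e where "active_leaves (split_leaves h) \<sigma> = [e]"
    "eval_ext_lexpr e \<sigma> = eval_linexp h \<sigma>" .
  moreover from Plus.IH(2) obtain e' where "active_leaves (split_leaves h') \<sigma> = [e']"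
    "eval_ext_lexpr e' \<sigma> = eval_linexp h' \<sigma>" .
  ultimately show ?case
    by (intro Plus.prems[of "ext_add e e'"]) (auto simp: active_leaves_map_leaves2 eval_ext_add)
qed simp

text \<open>Minimum does not distribute over sums of active leaves, so both operands are first
  brought to a form with a single one.\<close>

definition min_linexp :: "'v linexp \<Rightarrow> 'v linexp \<Rightarrow> 'v linexp" where
  "min_linexp h h' = map_leaves2 ext_min (split_leaves h) (split_leaves h')"

lemma eval_min_linexp:
  "eval_linexp (min_linexp h h') \<sigma> = min (eval_linexp h \<sigma>) (eval_linexp h' \<sigma>)"
proof -
  obtain e where "active_leaves (split_leaves h) \<sigma> = [e]"
    "eval_ext_lexpr e \<sigma> = eval_linexp h \<sigma>"
    by (rule active_leaves_split_leaves)
  moreover obtain e' where "active_leaves (split_leaves h') \<sigma> = [e']"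
    "eval_ext_lexpr e' \<sigma> = eval_linexp h' \<sigma>"
    by (rule active_leaves_split_leaves)
  ultimately show ?thesis
    \<comment> \<open>The rule is restricted to results of \<open>map_leaves2\<close>, which keeps
      the values of \<open>h\<close> and \<open>h'\<close> from being expanded into sums.\<close>
    by (simp add: eval_linexp_active_leaves[of "map_leaves2 f k k'" for f k k'] min_linexp_def
        active_leaves_map_leaves2 eval_ext_min)
qed


section \<open>Computability of the leafwise operations\<close>

definition computable_ext_binop ::
    "('v \<Rightarrow> nat) \<Rightarrow> ('v ext_lexpr \<Rightarrow> 'v ext_lexpr \<Rightarrow> 'v ext_lexpr) \<Rightarrow> bool" where
  "computable_ext_binop \<nu> F \<longleftrightarrow>
    (\<exists>g. recursive g \<and>
      (\<forall>e e'. g (prod_encode (encode_ext_lexpr \<nu> e, encode_ext_lexpr \<nu> e'))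
        = encode_ext_lexpr \<nu> (F e e')))"

lemma computable_ext_add: "computable_ext_binop \<nu> ext_add"
proof -
  \<comment> \<open>Tag 0 marks a finite operand and 3 is the tag of \<open>Add\<close>. An infinite
    operand is itself the code of the sum.\<close>
  define g where "g n =
    (let a = fst (prod_decode n); b = snd (prod_decode n) in
      if fst (prod_decode a) = 0 then
        if fst (prod_decode b) = 0
        then prod_encode (0, prod_encode (3, prod_encode (snd (prod_decode a), snd (prod_decode b))))
        else b
      else a)" for n
  have "recursive g"
    unfolding g_def Let_def by (intro recursive_intros)
  moreover have "g (prod_encode (encode_ext_lexpr \<nu> e, encode_ext_lexpr \<nu> e')) =
      encode_ext_lexpr \<nu> (ext_add e e')" for e e'
    by (cases e; cases e') (auto simp: g_def Let_def)
  ultimately show ?thesis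
    unfolding computable_ext_binop_def by blast
qed

lemma computable_ext_min: "computable_ext_binop \<nu> ext_min"
proof -
  define g where "g n =
    (let a = fst (prod_decode n); b = snd (prod_decode n);
        e = snd (prod_decode a); e' = snd (prod_decode b) in
      if fst (prod_decode a) = 0 then
        if fst (prod_decode b) = 0
        then prod_encode (0, prod_encode (4, prod_encode
          (e, prod_encode (4, prod_encode (e, e')))))
        else a
      else b)" for n
  have "recursive g"
    unfolding g_def Let_def by (intro recursive_intros)
  moreover have "g (prod_encode (encode_ext_lexpr \<nu> e, encode_ext_lexpr \<nu> e')) =
      encode_ext_lexpr \<nu> (ext_min e e')" for e e'
    by (cases e; cases e') (auto simp: g_def Let_def)
  ultimately show ?thesis
    unfolding computable_ext_binop_def by blast
qed

text \<open>Two nested folds: \<open>f1\<close> traverses \<open>k\<close> with a leaf of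
  \<open>h\<close> as parameter, and \<open>f2\<close> traverses \<open>h\<close> with
  \<open>k\<close> as parameter, calling \<open>f1\<close> at each leaf.\<close>

lemma recursive_map_leaves2:
  assumes "computable_ext_binop \<nu> F"
  obtains f where "recursive f"
    and "\<And>h k. f (prod_encode (encode_linexp \<nu> h, encode_linexp \<nu> k)) =
      encode_linexp \<nu> (map_leaves2 F h k)"
proof -
  obtain g where "recursive g" and
    g: "\<And>e e'. g (prod_encode (encode_ext_lexpr \<nu> e, encode_ext_lexpr \<nu> e')) =
      encode_ext_lexpr \<nu> (F e e')"
    using assms unfolding computable_ext_binop_def by blast
  \<comment> \<open>These combinators put the constructor tag back, leaving the tree shape
    unchanged.\<close>
  have I: "recursive (\<lambda>m. prod_encode (1, m))" and P: "recursive (\<lambda>m. prod_encode (2, m))"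
    by (intro recursive_intros)+
  have "recursive (\<lambda>m. prod_encode (0, g m))"
    by (intro recursive_intros recursive_comp[OF \<open>recursive g\<close>])
  from this I P obtain f1 where "recursive f1" and
    f1: "\<And>p e. f1 (prod_encode (p, encode_linexp \<nu> (Expr e))) =
        prod_encode (0, g (prod_encode (p, encode_ext_lexpr \<nu> e)))"
      "\<And>p \<phi> h. f1 (prod_encode (p, encode_linexp \<nu> (Iverson \<phi> h))) =
        prod_encode (1, prod_encode (encode_guard \<nu> \<phi>, f1 (prod_encode (p, encode_linexp \<nu> h))))"
      "\<And>p h h'. f1 (prod_encode (p, encode_linexp \<nu> (Plus h h'))) =
        prod_encode (2, prod_encode (f1 (prod_encode (p, encode_linexp \<nu> h)),
          f1 (prod_encode (p, encode_linexp \<nu> h'))))"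
    by (rule recursive_fold_linexp[where \<nu> = \<nu>]) blast
  have map_leaves: "f1 (prod_encode (encode_ext_lexpr \<nu> e, encode_linexp \<nu> k)) =
      encode_linexp \<nu> (map_leaves (F e) k)" for e k
    by (induction k) (simp_all only: f1 g map_leaves.simps, simp_all)
  \<comment> \<open>At a leaf of \<open>h\<close> the outer fold supplies the code of
    \<open>k\<close> first, whereas \<open>f1\<close> expects the leaf first; hence the
    swap.\<close>
  have "recursive (\<lambda>m. f1 (prod_encode (snd (prod_decode m), fst (prod_decode m))))"
    by (intro recursive_intros recursive_comp[OF \<open>recursive f1\<close>])
  from this I P obtain f2 where "recursive f2" and
    f2: "\<And>p e. f2 (prod_encode (p, encode_linexp \<nu> (Expr e))) =
        f1 (prod_encode (encode_ext_lexpr \<nu> e, p))"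
      "\<And>p \<phi> h. f2 (prod_encode (p, encode_linexp \<nu> (Iverson \<phi> h))) =
        prod_encode (1, prod_encode (encode_guard \<nu> \<phi>, f2 (prod_encode (p, encode_linexp \<nu> h))))"
      "\<And>p h h'. f2 (prod_encode (p, encode_linexp \<nu> (Plus h h'))) =
        prod_encode (2, prod_encode (f2 (prod_encode (p, encode_linexp \<nu> h)),
          f2 (prod_encode (p, encode_linexp \<nu> h'))))"
    by (rule recursive_fold_linexp[where \<nu> = \<nu>]) (simp del: encode_linexp.simps)
  have map_leaves2: "f2 (prod_encode (encode_linexp \<nu> k, encode_linexp \<nu> h)) =
      encode_linexp \<nu> (map_leaves2 F h k)" for h k
    by (induction h) (simp_all only: f2 map_leaves map_leaves2.simps, simp_all)
  show thesis
  proof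
    show "recursive (\<lambda>m. f2 (prod_encode (snd (prod_decode m), fst (prod_decode m))))"
      by (intro recursive_intros recursive_comp[OF \<open>recursive f2\<close>])
  qed (simp add: map_leaves2)
qed

lemma recursive_split_leaves:
  obtains f where "recursive f"
    and "\<And>h. f (encode_linexp \<nu> h) = encode_linexp \<nu> (split_leaves h)"
proof -
  obtain add where "recursive add" and
    add: "\<And>h k. add (prod_encode (encode_linexp \<nu> h, encode_linexp \<nu> k)) =
      encode_linexp \<nu> (map_leaves2 ext_add h k)"
    using recursive_map_leaves2[OF computable_ext_add] by blast
  \<comment> \<open>As \<open>m\<close> pairs the guard code with the split body,
    \<open>prod_encode (1, m)\<close> is already the code of the first summand. The code of the zero
    leaf is a fixed number.\<close>
  define I where "I m = prod_encode (2, prod_encode (prod_encode (1, m), prod_encode (1,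
    prod_encode (prod_encode (2, fst (prod_decode m)), encode_linexp \<nu> (Expr zero_ext)))))" for m
  have E: "recursive (\<lambda>m. prod_encode (0, snd (prod_decode m)))" and I: "recursive I"
    unfolding I_def by (intro recursive_intros)+
  from E I \<open>recursive add\<close> obtain f where "recursive f" and
    f: "\<And>p e. f (prod_encode (p, encode_linexp \<nu> (Expr e))) =
        prod_encode (0, encode_ext_lexpr \<nu> e)"
      "\<And>p \<phi> h. f (prod_encode (p, encode_linexp \<nu> (Iverson \<phi> h))) =
        I (prod_encode (encode_guard \<nu> \<phi>, f (prod_encode (p, encode_linexp \<nu> h))))"
      "\<And>p h h'. f (prod_encode (p, encode_linexp \<nu> (Plus h h'))) =
        add (prod_encode (f (prod_encode (p, encode_linexp \<nu> h)),
          f (prod_encode (p, encode_linexp \<nu> h'))))"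
    by (rule recursive_fold_linexp[where \<nu> = \<nu>]) (simp del: encode_linexp.simps)
  \<comment> \<open>The fold carries no information in its parameter here, so 0 is a dummy
    value.\<close>
  have "f (prod_encode (0, encode_linexp \<nu> h)) = encode_linexp \<nu> (split_leaves h)" for h
  proof (induction h)
    case (Iverson \<phi> h)
    then show ?case unfolding f by (simp add: I_def)
  qed (simp_all only: f add split_leaves.simps, simp)
  then show thesis
    using that[OF recursive_comp[OF \<open>recursive f\<close>, of "\<lambda>m. prod_encode (0, m)"]]
    by (simp add: recursive_intros)
qed

lemma computable_min_linexp: "computable_binop \<nu> min_linexp"
proof -
  obtain m where "recursive m" and
    m: "\<And>h k. m (prod_encode (encode_linexp \<nu> h, encode_linexp \<nu> k)) =
      encode_linexp \<nu> (map_leaves2 ext_min h k)"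
    using recursive_map_leaves2[OF computable_ext_min] by blast
  obtain s where "recursive s" and
    s: "\<And>h. s (encode_linexp \<nu> h) = encode_linexp \<nu> (split_leaves h)"
    using recursive_split_leaves by blast
  have "recursive (\<lambda>n. m (prod_encode (s (fst (prod_decode n)), s (snd (prod_decode n)))))"
    by (intro recursive_intros recursive_comp[OF \<open>recursive m\<close>] recursive_comp[OF \<open>recursive s\<close>])
  then show ?thesis
    unfolding computable_binop_def recursive_def
    by (intro exI conjI, assumption) (simp add: m s min_linexp_def)
qed

theorem theorem8:
  fixes \<nu> :: "'v :: finite \<Rightarrow> nat"
  assumes "inj \<nu>"
  shows "\<exists>minimum :: 'v linexp \<Rightarrow> 'v linexp \<Rightarrow> 'v linexp.
    computable_binop \<nu> minimum \<and>
    (\<forall>h h' \<sigma>. eval_linexp (minimum h h') \<sigma> = min (eval_linexp h \<sigma>) (eval_linexp h' \<sigma>))"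
  using computable_min_linexp eval_min_linexp by blast

end
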